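(* Let $(\mathfrak{g},\omega)$ be a pre-Lie algebra over $\mathbb{R}$ (with product $x\triangleright y=\omega(x,y)$). If $\mathcal{H}^2_{\mathsf{PL}}(\mathfrak{g};\mathfrak{g})=0$, then $(\mathfrak{g},\omega)$ is post-Lie rigid, i.e. every formal post-Lie deformation of $(\mathfrak{g},\omega)$ is trivial.
   Context: A post-Lie algebra $(\mathfrak{g},[\cdot,\cdot],\triangleright)$ is a Lie algebra $(\mathfrak{g},[\cdot,\cdot])$ with a bilinear product $\triangleright$ such that $x\triangleright[y,z]=[x\triangleright y,z]+[y,x\triangleright z]$ and $([x,y]+x\triangleright y-y\triangleright x)\triangleright z=x\triangleright(y\triangleright z)-y\triangleright(x\triangleright z)$. A pre-Lie algebra $(\mathfrak{g},\triangleright)$ is a post-Lie algebra with zero bracket. **Formal deformations.** Let $\pi_t=\sum_{i\ge0}\pi_it^i$ and $\omega_t=\sum_{i\ge0}\omega_it^i$ with $\pi_i\in\mathrm{Hom}_{\mathbb{R}}(\wedge^2\mathfrak{g},\mathfrak{g})$, $\omega_i\in\mathrm{Hom}_{\mathbb{R}}(\mathfrak{g}\otimes\mathfrak{g},\mathfrak{g})$, extended to $\mathfrak{g}[[t]]$ by $\big(\sum_jx_jt^j,\sum_ky_kt^k\big)\mapsto\sum_{i,j,k}\pi_i(x_j,y_k)t^{i+j+k}$ (and likewise for $\omega_t$). The pair $(\pi_t,\omega_t)$ is a formal post-Lie deformation of $(\mathfrak{g},\omega)$ if $(\mathfrak{g}[[t]],\pi_t,\omega_t)$ is an $\mathbb{R}[[t]]$-post-Lie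 algebra (with Lie bracket $\pi_t$ and product $\omega_t$) and $(\pi_0,\omega_0)=(0,\omega)$. **Triviality.** A formal post-Lie deformation $(\pi_t,\omega_t)$ is trivial if it is equivalent to the deformation $(0,\omega)$, i.e. there is $\Phi_t=\sum_{i\ge0}\phi_it^i:\mathfrak{g}[[t]]\to\mathfrak{g}[[t]]$ with $\phi_i\in\mathrm{Hom}_{\mathbb{R}}(\mathfrak{g},\mathfrak{g})$ and $\phi_0=\mathrm{Id}$ such that $\Phi_t\circ\pi_t=0$ and $\Phi_t\circ\omega_t=\omega\circ(\Phi_t\times\Phi_t)$. **Cohomology in low degree.** The post-Lie cochain complex of $(\mathfrak{g},\triangleright)$ has $\mathfrak{C}^1_{\mathsf{PL}}(\mathfrak{g};\mathfrak{g})=\mathrm{Hom}(\mathfrak{g},\mathfrak{g})$ and $\mathfrak{C}^2_{\mathsf{PL}}(\mathfrak{g};\mathfrak{g})=\mathrm{Hom}(\wedge^2\mathfrak{g},\mathfrak{g})\oplus\mathrm{Hom}(\mathfrak{g}\otimes\mathfrak{g},\mathfrak{g})$. For $\phi\in\mathfrak{C}^1_{\mathsf{PL}}(\mathfrak{g};\mathfrak{g})$, $\partial\phi=(0,(x,y)\mapsto\phi(x)\triangleright y+x\triangleright\phi(y)-\phi(x\triangleright y))$. For $(\pi',\omega')\in\mathfrak{C}^2_{\mathsf{PL}}(\mathfrak{g};\mathfrak{g})$, $\partial(\pi',\omega')$ has the components (zero in $\mathrm{Hom}(\wedge^3\mathfrak{g},\mathfrak{g})$) $$\partial(\pi',\omega')_1(x;y,z)=x\triangleright\pi'(y,z)-\pi'(x\triangleright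 y,z)+\pi'(x\triangleright z,y),$$ $$\partial(\pi',\omega')_2(x,y;z)=-\big(\omega'(x,y)-\omega'(y,x)+\pi'(x,y)\big)\triangleright z-\omega'(x\triangleright y-y\triangleright x,z)+\omega'(x,y\triangleright z)+x\triangleright\omega'(y,z)-\omega'(y,x\triangleright z)-y\triangleright\omega'(x,z).$$ $\mathcal{H}^2_{\mathsf{PL}}(\mathfrak{g};\mathfrak{g})$ is the space of $2$-cocycles $\{(\pi',\omega'):\partial(\pi',\omega')=0\}$ modulo $\partial(\mathfrak{C}^1_{\mathsf{PL}}(\mathfrak{g};\mathfrak{g}))$. *)

theory Defs
  imports
    "HOL-Computational_Algebra.Formal_Power_Series"
    "HOL-Library.Function_Algebras"
    "HOL-Library.Product_Plus"
    "HOL-Library.Set_Algebras"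
begin

section \<open>Post-Lie algebras over a commutative ring\<close>

definition bilinear_over ::
  "('r::comm_ring_1 \<Rightarrow> 'm::ab_group_add \<Rightarrow> 'm) \<Rightarrow> ('m \<Rightarrow> 'm \<Rightarrow> 'm) \<Rightarrow> bool" where
  "bilinear_over s f \<longleftrightarrow>
     (\<forall>x. module_hom s s (f x)) \<and> (\<forall>y. module_hom s s (\<lambda>x. f x y))"

definition alternating :: "('m \<Rightarrow> 'm \<Rightarrow> 'n::zero) \<Rightarrow> bool" where
  "alternating f \<longleftrightarrow> (\<forall>x. f x x = 0)"

locale lie_algebra_over = module scale
  for scale :: "'r::comm_ring_1 \<Rightarrow> 'm::ab_group_add \<Rightarrow> 'm" +
  fixes br :: "'m \<Rightarrow> 'm \<Rightarrow> 'm"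
  assumes br_bilinear: "bilinear_over scale br"
    and br_alternating: "alternating br"
    and br_jacobi: "br x (br y z) + br y (br z x) + br z (br x y) = 0"

locale post_lie_algebra = lie_algebra_over scale br
  for scale :: "'r::comm_ring_1 \<Rightarrow> 'm::ab_group_add \<Rightarrow> 'm"
    and br :: "'m \<Rightarrow> 'm \<Rightarrow> 'm" +
  fixes tri :: "'m \<Rightarrow> 'm \<Rightarrow> 'm"
  assumes tri_bilinear: "bilinear_over scale tri"
    and tri_derivation: "tri x (br y z) = br (tri x y) z + br y (tri x z)"
    and tri_action:
      "tri (br x y + tri x y - tri y x) z = tri x (tri y z) - tri y (tri x z)"

definition pre_lie_algebra ::
  "('r::comm_ring_1 \<Rightarrow> 'm::ab_group_add \<Rightarrow> 'm) \<Rightarrow> ('m \<Rightarrow> 'm \<Rightarrow> 'm) \<Rightarrow> bool" where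
  "pre_lie_algebra s tri \<longleftrightarrow> post_lie_algebra s (\<lambda>_ _. 0) tri"


section \<open>Formal power series with coefficients in a real vector space\<close>

text \<open>The \<open>\<real>[[t]]\<close>-module \<open>\<gg>[[t]]\<close> is the type \<^typ>\<open>'a fps\<close> for
  a real vector space \<^typ>\<open>'a\<close>, with scalar multiplication the Cauchy product.\<close>

definition fps_scaleR :: "real fps \<Rightarrow> 'a::real_vector fps \<Rightarrow> 'a fps" where
  "fps_scaleR a X = Abs_fps (\<lambda>n. \<Sum>i=0..n. fps_nth a i *\<^sub>R fps_nth X (n - i))"

lemma module_fps_scaleR: "module (fps_scaleR :: real fps \<Rightarrow> 'a::real_vector fps \<Rightarrow> 'a fps)"
proof
  fix a b :: "real fps" and X Y :: "'a fps"
  show "fps_scaleR a (X + Y) = fps_scaleR a X + fps_scaleR a Y"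
    by (simp add: fps_eq_iff fps_scaleR_def scaleR_add_right sum.distrib)
  show "fps_scaleR (a + b) X = fps_scaleR a X + fps_scaleR b X"
    by (simp add: fps_eq_iff fps_scaleR_def scaleR_add_left sum.distrib)
  show "fps_scaleR 1 X = X"
  proof (rule fps_ext)
    fix n
    have "fps_nth (fps_scaleR 1 X) n
        = (\<Sum>i=0..n. if i = 0 then fps_nth X n else 0)"
      unfolding fps_scaleR_def fps_nth_Abs_fps by (rule sum.cong) auto
    then show "fps_nth (fps_scaleR 1 X) n = fps_nth X n" by simp
  qed
  show "fps_scaleR a (fps_scaleR b X) = fps_scaleR (a * b) X"
  proof (rule fps_ext)
    fix n
    have "(\<Sum>j=0..n. \<Sum>i=0..j. (fps_nth a i * fps_nth b (j - i)) *\<^sub>R fps_nth X (n - j))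
        = (\<Sum>j=0..n. \<Sum>i=0..n - j. (fps_nth a j * fps_nth b i) *\<^sub>R fps_nth X (n - j - i))"
      by (rule fps_mult_assoc_lemma)
    then show "fps_nth (fps_scaleR a (fps_scaleR b X)) n = fps_nth (fps_scaleR (a * b) X) n"
      by (simp add: fps_scaleR_def fps_mult_nth scaleR_sum_left scaleR_sum_right)
  qed
qed

text \<open>A family \<open>(\<phi>\<^sub>i)\<close> of maps stands for \<open>\<Sum>\<^sub>i \<phi>\<^sub>i t\<^sup>i\<close>, acting on
  \<open>\<gg>[[t]]\<close>; the sums below range over all \<open>i + j = n\<close>, respectively
  \<open>i + j + k = n\<close>.\<close>

definition fps_extend ::
  "(nat \<Rightarrow> 'a::comm_monoid_add \<Rightarrow> 'a) \<Rightarrow> 'a fps \<Rightarrow> 'a fps" where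
  "fps_extend \<phi> X = Abs_fps (\<lambda>n. \<Sum>i=0..n. \<phi> i (fps_nth X (n - i)))"

definition fps_extend2 ::
  "(nat \<Rightarrow> 'a::comm_monoid_add \<Rightarrow> 'a \<Rightarrow> 'a) \<Rightarrow> 'a fps \<Rightarrow> 'a fps \<Rightarrow> 'a fps" where
  "fps_extend2 f X Y =
     Abs_fps (\<lambda>n. \<Sum>i=0..n. \<Sum>j=0..n - i. f i (fps_nth X j) (fps_nth Y (n - i - j)))"

definition constant_family :: "('a \<Rightarrow> 'a \<Rightarrow> 'a::zero) \<Rightarrow> nat \<Rightarrow> 'a \<Rightarrow> 'a \<Rightarrow> 'a" where
  "constant_family f i = (if i = 0 then f else (\<lambda>_ _. 0))"


section \<open>Formal post-Lie deformations of a pre-Lie algebra\<close>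

definition formal_post_lie_deformation ::
  "('a::real_vector \<Rightarrow> 'a \<Rightarrow> 'a) \<Rightarrow> (nat \<Rightarrow> 'a \<Rightarrow> 'a \<Rightarrow> 'a) \<Rightarrow> (nat \<Rightarrow> 'a \<Rightarrow> 'a \<Rightarrow> 'a) \<Rightarrow> bool"
where
  "formal_post_lie_deformation \<omega> \<pi>t \<omega>t \<longleftrightarrow>
     (\<forall>i. bilinear_over scaleR (\<pi>t i) \<and> alternating (\<pi>t i)) \<and>
     (\<forall>i. bilinear_over scaleR (\<omega>t i)) \<and>
     post_lie_algebra fps_scaleR (fps_extend2 \<pi>t) (fps_extend2 \<omega>t) \<and>
     \<pi>t 0 = (\<lambda>_ _. 0) \<and> \<omega>t 0 = \<omega>"

definition trivial_deformation ::
  "('a::real_vector \<Rightarrow> 'a \<Rightarrow> 'a) \<Rightarrow> (nat \<Rightarrow> 'a \<Rightarrow> 'a \<Rightarrow> 'a) \<Rightarrow> (nat \<Rightarrow> 'a \<Rightarrow> 'a \<Rightarrow> 'a) \<Rightarrow> bool"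
where
  "trivial_deformation \<omega> \<pi>t \<omega>t \<longleftrightarrow>
     (\<exists>\<phi>. (\<forall>i. linear (\<phi> i)) \<and> \<phi> 0 = id \<and>
        (\<forall>X Y. fps_extend \<phi> (fps_extend2 \<pi>t X Y) = 0) \<and>
        (\<forall>X Y. fps_extend \<phi> (fps_extend2 \<omega>t X Y) =
           fps_extend2 (constant_family \<omega>) (fps_extend \<phi> X) (fps_extend \<phi> Y)))"

definition post_lie_rigid :: "('a::real_vector \<Rightarrow> 'a \<Rightarrow> 'a) \<Rightarrow> bool" where
  "post_lie_rigid \<omega> \<longleftrightarrow>
     (\<forall>\<pi>t \<omega>t. formal_post_lie_deformation \<omega> \<pi>t \<omega>t \<longrightarrow> trivial_deformation \<omega> \<pi>t \<omega>t)"


section \<open>Post-Lie cohomology of a pre-Lie algebra in degree two\<close>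

type_synonym 'a pl_cochain2 = "('a \<Rightarrow> 'a \<Rightarrow> 'a) \<times> ('a \<Rightarrow> 'a \<Rightarrow> 'a)"

type_synonym 'a pl_cochain3 =
  "('a \<Rightarrow> 'a \<Rightarrow> 'a \<Rightarrow> 'a) \<times> ('a \<Rightarrow> 'a \<Rightarrow> 'a \<Rightarrow> 'a) \<times> ('a \<Rightarrow> 'a \<Rightarrow> 'a \<Rightarrow> 'a)"

definition pl_C1 :: "('a::real_vector \<Rightarrow> 'a) set" where
  "pl_C1 = {\<phi>. linear \<phi>}"

definition pl_C2 :: "'a::real_vector pl_cochain2 set" where
  "pl_C2 = {(\<pi>, \<omega>). bilinear_over scaleR \<pi> \<and> alternating \<pi> \<and> bilinear_over scaleR \<omega>}"

definition pl_d1 ::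
  "('a::real_vector \<Rightarrow> 'a \<Rightarrow> 'a) \<Rightarrow> ('a \<Rightarrow> 'a) \<Rightarrow> 'a pl_cochain2" where
  "pl_d1 tri \<phi> = ((\<lambda>_ _. 0), (\<lambda>x y. tri (\<phi> x) y + tri x (\<phi> y) - \<phi> (tri x y)))"

definition pl_d2 ::
  "('a::real_vector \<Rightarrow> 'a \<Rightarrow> 'a) \<Rightarrow> 'a pl_cochain2 \<Rightarrow> 'a pl_cochain3" where
  "pl_d2 tri c = (case c of (\<pi>', \<omega>') \<Rightarrow>
     ((\<lambda>_ _ _. 0),
      (\<lambda>x y z. tri x (\<pi>' y z) - \<pi>' (tri x y) z + \<pi>' (tri x z) y),
      (\<lambda>x y z. - tri (\<omega>' x y - \<omega>' y x + \<pi>' x y) z - \<omega>' (tri x y - tri y x) z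
        + \<omega>' x (tri y z) + tri x (\<omega>' y z) - \<omega>' y (tri x z) - tri y (\<omega>' x z))))"

definition pl_Z2 :: "('a::real_vector \<Rightarrow> 'a \<Rightarrow> 'a) \<Rightarrow> 'a pl_cochain2 set" where
  "pl_Z2 tri = {c \<in> pl_C2. pl_d2 tri c = 0}"

definition pl_B2 :: "('a::real_vector \<Rightarrow> 'a \<Rightarrow> 'a) \<Rightarrow> 'a pl_cochain2 set" where
  "pl_B2 tri = pl_d1 tri ` pl_C1"

text \<open>The quotient is represented by its set of cosets, so the second cohomology
  vanishes iff it consists of the zero coset, the coboundaries, alone.\<close>

definition pl_H2 :: "('a::real_vector \<Rightarrow> 'a \<Rightarrow> 'a) \<Rightarrow> 'a pl_cochain2 set set" where
  "pl_H2 tri = (\<lambda>c. c +o pl_B2 tri) ` pl_Z2 tri"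

end

theory Submission
  imports Defs
begin

text \<open>Order by order, the coefficients \<open>\<phi>\<^sub>n\<close> of an equivalence with the constant deformation are
  constructed. If the truncation \<open>\<Phi> = \<Sum>\<^sub>i\<^sub><\<^sub>n \<phi>\<^sub>i t\<^sup>i\<close> intertwines \<open>\<omega>\<^sub>t\<close> with \<open>\<omega>\<close> up to an error
  \<open>E t\<^sup>n\<close>, and \<open>\<pi>\<^sub>i = 0\<close> for \<open>i < n\<close>, then the coefficient of \<open>t\<^sup>n\<close> in \<open>\<Phi>\<close> applied to the post-Lie
  identities says that \<open>(\<pi>\<^sub>n, E)\<close> is a 2-cocycle. It is therefore a coboundary, which means
  \<open>\<pi>\<^sub>n = 0\<close> and \<open>E = \<partial>\<phi>\<^sub>n\<close>; adding \<open>\<phi>\<^sub>n t\<^sup>n\<close> to \<open>\<Phi>\<close> removes the error.\<close>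

section \<open>Bilinear maps and triangular sums\<close>

lemma
  assumes "bilinear_over s f"
  shows bilinear_over_add_left: "f (x + x') y = f x y + f x' y"
    and bilinear_over_add_right: "f x (y + y') = f x y + f x y'"
    and bilinear_over_diff_left: "f (x - x') y = f x y - f x' y"
    and bilinear_over_zero_left: "f 0 y = 0"
    and bilinear_over_zero_right: "f x 0 = 0"
    and bilinear_over_neg_left: "f (- x) y = - f x y"
    and bilinear_over_sum_left: "f (sum g I) y = (\<Sum>i\<in>I. f (g i) y)"
    and bilinear_over_sum_right: "f x (sum g I) = (\<Sum>i\<in>I. f x (g i))"
  using assms unfolding bilinear_over_def
  by (simp_all add: module_hom.add[of s s "f x"] module_hom.add[of s s "\<lambda>x. f x y"]
     module_hom.diff[of s s "\<lambda>x. f x y"]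
      module_hom.zero[of s s "f x"] module_hom.zero[of s s "\<lambda>x. f x y"]
      module_hom.neg[of s s "\<lambda>x. f x y"]
      module_hom.sum[of s s "f x"] module_hom.sum[of s s "\<lambda>x. f x y"])

lemma bilinear_over_scaleR_iff_linear:
  "bilinear_over scaleR f \<longleftrightarrow> (\<forall>x. linear (f x)) \<and> (\<forall>y. linear (\<lambda>x. f x y))"
  unfolding bilinear_over_def linear_def module_hom_iff_linear ..

lemma alternating_swap:
  assumes "bilinear_over s f" "alternating f"
  shows "f y x = - f x y"
proof -
  have "f (x + y) (x + y) = f x x + f y y + (f x y + f y x)"
    by (simp add: bilinear_over_add_left[OF assms(1)] bilinear_over_add_right[OF assms(1)]
        algebra_simps)
  then show ?thesis
    using assms(2) by (simp add: alternating_def eq_neg_iff_add_eq_0 add.commute)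
qed

text \<open>Both double sums range over the pairs with \<open>i + j \<le> n\<close>; written as a
  filter on a square, this range allows the exchange.\<close>

lemma sum_triangle_swap:
  fixes f :: "nat \<Rightarrow> nat \<Rightarrow> 'a::comm_monoid_add"
  shows "(\<Sum>i=0..n. \<Sum>j=0..n - i. f i j) = (\<Sum>j=0..n. \<Sum>i=0..n - j. f i j)"
proof -
  have "(\<Sum>i=0..n. \<Sum>j=0..n - i. f i j) = (\<Sum>i=0..n. \<Sum>j | j \<in> {0..n} \<and> i + j \<le> n. f i j)"
    by (intro sum.cong) auto
  also have "\<dots> = (\<Sum>j=0..n. \<Sum>i | i \<in> {0..n} \<and> i + j \<le> n. f i j)"
    by (rule sum.swap_restrict) auto
  also have "\<dots> = (\<Sum>j=0..n. \<Sum>i=0..n - j. f i j)"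
    by (intro sum.cong) auto
  finally show ?thesis .
qed

section \<open>Coefficients of extended families of maps\<close>

lemma fps_extend_add:
  assumes "\<And>i. linear (\<phi> i)"
  shows "fps_extend \<phi> (X + Y) = fps_extend \<phi> X + fps_extend \<phi> Y"
  by (simp add: fps_eq_iff fps_extend_def linear_add[OF assms] sum.distrib)

lemma fps_extend_diff:
  assumes "\<And>i. linear (\<phi> i)"
  shows "fps_extend \<phi> (X - Y) = fps_extend \<phi> X - fps_extend \<phi> Y"
  by (simp add: fps_eq_iff fps_extend_def linear_diff[OF assms] sum_subtractf)

text \<open>The hypothesis removes every \<open>i < n\<close>, and \<open>i = n\<close> leaves room
  only for constant terms. This turns identities on power series into identities on the underlying
  space.\<close>

lemma fps_extend2_lowest_coeff:
  assumes "\<And>k. k < n \<Longrightarrow> f k = (\<lambda>_ _. 0)"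
  shows "fps_nth (fps_extend2 f X Y) n = f n (fps_nth X 0) (fps_nth Y 0)"
proof -
  have "fps_nth (fps_extend2 f X Y) n
      = (\<Sum>i=0..n. if i = n then f n (fps_nth X 0) (fps_nth Y 0) else 0)"
    unfolding fps_extend2_def fps_nth_Abs_fps by (rule sum.cong) (auto simp: assms)
  then show ?thesis by simp
qed

lemma fps_extend_lowest_coeff:
  assumes "\<And>i. linear (\<phi> i)" "\<And>k. k < n \<Longrightarrow> fps_nth X k = 0"
  shows "fps_nth (fps_extend \<phi> X) n = \<phi> 0 (fps_nth X n)"
proof -
  have "fps_nth (fps_extend \<phi> X) n = (\<Sum>i=0..n. if i = 0 then \<phi> 0 (fps_nth X n) else 0)"
    unfolding fps_extend_def fps_nth_Abs_fps
    by (rule sum.cong) (auto simp: assms linear_0[OF assms(1)])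
  then show ?thesis by simp
qed

lemma fps_nth_extend2_constant_family:
  "fps_nth (fps_extend2 (constant_family \<omega>) X Y) n
     = (\<Sum>j=0..n. \<omega> (fps_nth X j) (fps_nth Y (n - j)))"
proof -
  have "fps_nth (fps_extend2 (constant_family \<omega>) X Y) n
      = (\<Sum>i=0..n. if i = 0 then (\<Sum>j=0..n. \<omega> (fps_nth X j) (fps_nth Y (n - j))) else 0)"
    unfolding fps_extend2_def fps_nth_Abs_fps by (rule sum.cong) (auto simp: constant_family_def)
  then show ?thesis by simp
qed

lemma
  assumes "bilinear_over s \<omega>" "\<And>k. k < n \<Longrightarrow> fps_nth X k = 0"
  shows fps_extend2_constant_lowest_coeff_left:
      "fps_nth (fps_extend2 (constant_family \<omega>) X Y) n = \<omega> (fps_nth X n) (fps_nth Y 0)"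
    and fps_extend2_constant_lowest_coeff_right:
      "fps_nth (fps_extend2 (constant_family \<omega>) Y X) n = \<omega> (fps_nth Y 0) (fps_nth X n)"
proof -
  have "fps_nth (fps_extend2 (constant_family \<omega>) X Y) n
      = (\<Sum>j=0..n. if j = n then \<omega> (fps_nth X n) (fps_nth Y 0) else 0)"
    unfolding fps_nth_extend2_constant_family
    by (rule sum.cong) (auto simp: assms bilinear_over_zero_left[OF assms(1)])
  then show "fps_nth (fps_extend2 (constant_family \<omega>) X Y) n = \<omega> (fps_nth X n) (fps_nth Y 0)"
    by simp
  have "fps_nth (fps_extend2 (constant_family \<omega>) Y X) n
      = (\<Sum>j=0..n. if j = 0 then \<omega> (fps_nth Y 0) (fps_nth X n) else 0)"
    unfolding fps_nth_extend2_constant_family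
    by (rule sum.cong) (auto simp: assms bilinear_over_zero_right[OF assms(1)])
  then show "fps_nth (fps_extend2 (constant_family \<omega>) Y X) n = \<omega> (fps_nth Y 0) (fps_nth X n)"
    by simp
qed

lemma
  assumes "bilinear_over s \<omega>"
  shows fps_extend2_constant_add_left: "fps_extend2 (constant_family \<omega>) (X + X') Y
      = fps_extend2 (constant_family \<omega>) X Y + fps_extend2 (constant_family \<omega>) X' Y"
    and fps_extend2_constant_diff_left: "fps_extend2 (constant_family \<omega>) (X - X') Y
      = fps_extend2 (constant_family \<omega>) X Y - fps_extend2 (constant_family \<omega>) X' Y"
    and fps_extend2_constant_add_right: "fps_extend2 (constant_family \<omega>) X (Y + Y')
      = fps_extend2 (constant_family \<omega>) X Y + fps_extend2 (constant_family \<omega>) X Y'"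
  by (simp_all add: fps_eq_iff fps_nth_extend2_constant_family sum.distrib sum_subtractf
      bilinear_over_add_left[OF assms] bilinear_over_diff_left[OF assms]
      bilinear_over_add_right[OF assms])

text \<open>Composition of families is Cauchy convolution. The composite is again an
  \<open>fps_extend2\<close>, so it can be compared with other extensions family by family.\<close>

lemma fps_extend_extend2:
  assumes "\<And>i. linear (\<phi> i)"
  shows "fps_extend \<phi> (fps_extend2 f X Y)
     = fps_extend2 (\<lambda>k x y. \<Sum>i=0..k. \<phi> i (f (k - i) x y)) X Y"
proof (rule fps_ext)
  fix n
  define g where "g i j m = (\<Sum>l=0..m. \<phi> i (f j (fps_nth X l) (fps_nth Y (m - l))))" for i j m
  have "fps_nth (fps_extend \<phi> (fps_extend2 f X Y)) n
      = (\<Sum>i=0..n. \<Sum>j=0..n - i. g i j (n - i - j))"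
    by (simp add: fps_extend_def fps_extend2_def linear_sum[OF assms] g_def add.assoc)
  also have "\<dots> = (\<Sum>k=0..n. \<Sum>i=0..k. g i (k - i) (n - k))"
    by (rule fps_mult_assoc_lemma[symmetric])
  also have "\<dots> = fps_nth (fps_extend2 (\<lambda>k x y. \<Sum>i=0..k. \<phi> i (f (k - i) x y)) X Y) n"
    unfolding fps_extend2_def fps_nth_Abs_fps g_def by (intro sum.cong refl sum.swap)
  finally show "fps_nth (fps_extend \<phi> (fps_extend2 f X Y)) n = \<dots>" .
qed

text \<open>The degree is split among four indices: the orders of the two copies of
  \<open>\<phi>\<close> and the degrees of the coefficients of \<open>X\<close> and
  \<open>Y\<close>. Initially they are grouped by series; regrouping puts the two orders together,
  with sum \<open>k\<close>.\<close>

lemma fps_extend2_constant_extend: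
  assumes "bilinear_over s \<omega>"
  shows "fps_extend2 (constant_family \<omega>) (fps_extend \<phi> X) (fps_extend \<phi> Y)
     = fps_extend2 (\<lambda>k x y. \<Sum>i=0..k. \<omega> (\<phi> i x) (\<phi> (k - i) y)) X Y"
proof (rule fps_ext)
  fix n
  define h where "h i l j m = \<omega> (\<phi> i (fps_nth X l)) (\<phi> j (fps_nth Y m))" for i l j m
  have "fps_nth (fps_extend2 (constant_family \<omega>) (fps_extend \<phi> X) (fps_extend \<phi> Y)) n
      = (\<Sum>a=0..n. \<Sum>i=0..a. \<Sum>j=0..n - a. h i (a - i) j (n - a - j))"
    unfolding fps_nth_extend2_constant_family fps_extend_def fps_nth_Abs_fps h_def
    by (simp only: bilinear_over_sum_left[OF assms]) (simp only: bilinear_over_sum_right[OF assms])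
  \<comment> \<open>Here \<open>fps_mult_assoc_lemma\<close> only reindexes a triple sum; the share
    of \<open>Y\<close> is carried along as a function of the remaining degree.\<close>
  also have "\<dots> = (\<Sum>i=0..n. \<Sum>l=0..n - i. \<Sum>j=0..n - i - l. h i l j (n - i - l - j))"
    by (rule fps_mult_assoc_lemma[where f = "\<lambda>i l m. \<Sum>j=0..m. h i l j (m - j)"])
  also have "\<dots> = (\<Sum>i=0..n. \<Sum>j=0..n - i. \<Sum>l=0..n - i - j. h i l j (n - i - l - j))"
    by (intro sum.cong refl sum_triangle_swap)
  also have "\<dots> = (\<Sum>i=0..n. \<Sum>j=0..n - i. \<Sum>l=0..n - i - j. h i l j (n - i - j - l))"
    by (simp add: add.commute add.left_commute)
  also have "\<dots> = (\<Sum>k=0..n. \<Sum>i=0..k. \<Sum>l=0..n - k. h i l (k - i) (n - k - l))"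
    by (rule fps_mult_assoc_lemma[where f = "\<lambda>i j m. \<Sum>l=0..m. h i l j (m - l)", symmetric])
  also have "\<dots> = fps_nth (fps_extend2 (\<lambda>k x y. \<Sum>i=0..k. \<omega> (\<phi> i x) (\<phi> (k - i) y)) X Y) n"
    unfolding fps_extend2_def fps_nth_Abs_fps h_def by (intro sum.cong refl sum.swap)
  finally show "fps_nth (fps_extend2 (constant_family \<omega>) (fps_extend \<phi> X) (fps_extend \<phi> Y)) n
      = \<dots>" .
qed

section \<open>Left symmetry and vanishing cohomology\<close>

lemma pre_lie_algebra_bilinear: "pre_lie_algebra s \<omega> \<Longrightarrow> bilinear_over s \<omega>"
  by (simp add: pre_lie_algebra_def post_lie_algebra.tri_bilinear)

lemma pre_lie_algebra_left_symmetric: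
  assumes "pre_lie_algebra s \<omega>"
  shows "\<omega> (\<omega> x y) z - \<omega> x (\<omega> y z) = \<omega> (\<omega> y x) z - \<omega> y (\<omega> x z)"
  using post_lie_algebra.tri_action[OF assms[unfolded pre_lie_algebra_def], of x y z]
  by (simp add: bilinear_over_diff_left[OF pre_lie_algebra_bilinear[OF assms]] algebra_simps)

text \<open>Each coefficient is a sum of associators of \<open>\<omega>\<close> over a triangle of
  indices, so the symmetry of the associator in its first two arguments passes to series.\<close>

lemma fps_extend2_constant_left_symmetric:
  fixes \<omega> :: "'a::ab_group_add \<Rightarrow> 'a \<Rightarrow> 'a"
  assumes "pre_lie_algebra s \<omega>"
  defines "W \<equiv> fps_extend2 (constant_family \<omega>)"
  shows "W (W X Y) Z - W X (W Y Z) = W (W Y X) Z - W Y (W X Z)"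
proof (rule fps_ext)
  fix n
  note bil = pre_lie_algebra_bilinear[OF assms(1)]
  define a where "a x y z = \<omega> (\<omega> x y) z - \<omega> x (\<omega> y z)" for x y z
  have coeff: "fps_nth (W (W X Y) Z - W X (W Y Z)) n
      = (\<Sum>i=0..n. \<Sum>j=0..n - i. a (fps_nth X i) (fps_nth Y j) (fps_nth Z (n - i - j)))"
    for X Y Z
  proof -
    have "fps_nth (W (W X Y) Z) n
        = (\<Sum>j=0..n. \<Sum>i=0..j. \<omega> (\<omega> (fps_nth X i) (fps_nth Y (j - i))) (fps_nth Z (n - j)))"
      by (simp add: W_def fps_nth_extend2_constant_family bilinear_over_sum_left[OF bil])
    also have "\<dots> = (\<Sum>i=0..n. \<Sum>j=0..n - i.
        \<omega> (\<omega> (fps_nth X i) (fps_nth Y j)) (fps_nth Z (n - i - j)))"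
      by (rule fps_mult_assoc_lemma)
    finally show ?thesis
      by (simp add: W_def fps_nth_extend2_constant_family bilinear_over_sum_right[OF bil]
          a_def sum_subtractf)
  qed
  have "a x y z = a y x z" for x y z
    unfolding a_def by (rule pre_lie_algebra_left_symmetric[OF assms(1)])
  then have "fps_nth (W (W X Y) Z - W X (W Y Z)) n
      = (\<Sum>i=0..n. \<Sum>j=0..n - i. a (fps_nth Y j) (fps_nth X i) (fps_nth Z (n - i - j)))"
    unfolding coeff by presburger
  also have "\<dots> = (\<Sum>j=0..n. \<Sum>i=0..n - j. a (fps_nth Y j) (fps_nth X i) (fps_nth Z (n - i - j)))"
    by (rule sum_triangle_swap)
  also have "\<dots> = fps_nth (W (W Y X) Z - W Y (W X Z)) n"
    unfolding coeff by (simp add: add.commute)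
  finally show "fps_nth (W (W X Y) Z - W X (W Y Z)) n = \<dots>" .
qed

text \<open>A coset equal to \<open>pl_B2 \<omega>\<close> has its representative there because 0 is
  a coboundary, namely that of the zero map.\<close>

lemma pl_Z2_subset_B2:
  assumes "bilinear_over scaleR \<omega>" "pl_H2 \<omega> = {pl_B2 \<omega>}"
  shows "pl_Z2 \<omega> \<subseteq> pl_B2 \<omega>"
proof
  fix c assume "c \<in> pl_Z2 \<omega>"
  then have coset: "c +o pl_B2 \<omega> = pl_B2 \<omega>"
    using assms(2) unfolding pl_H2_def by blast
  have "pl_d1 \<omega> (\<lambda>_. 0) \<in> pl_B2 \<omega>"
    unfolding pl_B2_def pl_C1_def by (auto simp: module_hom_zero)
  then have "0 \<in> pl_B2 \<omega>"
    by (simp add: pl_d1_def bilinear_over_zero_left[OF assms(1)]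
        bilinear_over_zero_right[OF assms(1)] zero_prod_def zero_fun_def)
  then have "c + 0 \<in> c +o pl_B2 \<omega>" by (rule set_plus_intro2)
  then show "c \<in> pl_B2 \<omega>" using coset by simp
qed

section \<open>Error terms of a formal map between the two products\<close>

definition intertwining_defect ::
  "('a::ab_group_add \<Rightarrow> 'a \<Rightarrow> 'a) \<Rightarrow> (nat \<Rightarrow> 'a \<Rightarrow> 'a \<Rightarrow> 'a) \<Rightarrow> (nat \<Rightarrow> 'a \<Rightarrow> 'a) \<Rightarrow> nat \<Rightarrow> 'a \<Rightarrow> 'a \<Rightarrow> 'a"
where
  "intertwining_defect \<omega> \<omega>t \<phi> k x y =
     (\<Sum>i=0..k. \<phi> i (\<omega>t (k - i) x y)) - (\<Sum>i=0..k. \<omega> (\<phi> i x) (\<phi> (k - i) y))"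

text \<open>Both composites extend convolution families, and the defect is the difference of these
  families, order by order. Once it vanishes at every order, this is the intertwining condition of
  \<open>trivial_deformation\<close>.\<close>

lemma fps_extend2_intertwining_defect:
  assumes "bilinear_over s \<omega>" "\<And>i. linear (\<phi> i)"
  shows "fps_extend \<phi> (fps_extend2 \<omega>t X Y)
     = fps_extend2 (constant_family \<omega>) (fps_extend \<phi> X) (fps_extend \<phi> Y)
       + fps_extend2 (intertwining_defect \<omega> \<omega>t \<phi>) X Y"
  unfolding fps_extend_extend2[OF assms(2)] fps_extend2_constant_extend[OF assms(1)]
  by (simp add: fps_eq_iff fps_extend2_def intertwining_defect_def sum_subtractf)

lemma intertwining_defect_bilinear:
  assumes "bilinear_over scaleR \<omega>" "\<And>i. bilinear_over scaleR (\<omega>t i)" "\<And>i. linear (\<phi> i)"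
  shows "bilinear_over scaleR (intertwining_defect \<omega> \<omega>t \<phi> k)"
proof -
  have lin: "linear (\<omega> x)" "linear (\<lambda>x. \<omega> x y)" "linear (\<omega>t i x)" "linear (\<lambda>x. \<omega>t i x y)" for x y i
    using assms(1,2) by (simp_all add: bilinear_over_scaleR_iff_linear)
  note comp = linear_compose[unfolded o_def]
  show ?thesis
    unfolding bilinear_over_scaleR_iff_linear intertwining_defect_def
    by (intro conjI allI linear_compose_sub linear_compose_sum ballI
        comp[OF lin(3) assms(3)] comp[OF lin(4) assms(3)]
        comp[OF assms(3) lin(1)] comp[OF assms(3) lin(2)])
qed

text \<open>A new coefficient \<open>r\<close> of order \<open>n\<close> enters the defect of that order only through the extreme
  summands, where it meets \<open>\<phi>\<^sub>0 = id\<close> and \<open>\<omega>\<^sub>0 = \<omega>\<close>.\<close>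

lemma intertwining_defect_upd:
  assumes "n > 0" "\<phi> 0 = id" "\<omega>t 0 = \<omega>" "bilinear_over s \<omega>"
  shows "intertwining_defect \<omega> \<omega>t (\<phi>(n := r)) n x y
     = intertwining_defect \<omega> \<omega>t (\<phi>(n := \<lambda>_. 0)) n x y - snd (pl_d1 \<omega> r) x y"
proof -
  obtain m where m: "n = Suc m" using assms(1) by (cases n) auto
  have 1: "(\<Sum>i=0..n. (\<phi>(n := r)) i (\<omega>t (n - i) x y))
     = (\<Sum>i=0..m. \<phi> i (\<omega>t (n - i) x y)) + r (\<omega> x y)" for r
    by (simp add: m assms(3))
  have 2: "(\<Sum>i=0..n. \<omega> ((\<phi>(n := r)) i x) ((\<phi>(n := r)) (n - i) y))
     = \<omega> x (r y) + \<omega> (r x) y + (\<Sum>i=1..m. \<omega> (\<phi> i x) (\<phi> (n - i) y))" for r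
  proof -
    \<comment> \<open>For \<open>1 \<le> i \<le> m\<close> neither \<open>i\<close> nor
      \<open>n - i\<close> is \<open>n\<close>, so the update is invisible between the two
      ends.\<close>
    have "(\<Sum>i=1..m. \<omega> ((\<phi>(n := r)) i x) ((\<phi>(n := r)) (n - i) y))
        = (\<Sum>i=1..m. \<omega> (\<phi> i x) (\<phi> (n - i) y))"
      by (rule sum.cong) (auto simp: m)
    then show ?thesis
      by (simp add: m sum.atLeast_Suc_atMost[of 0] assms(2) algebra_simps)
  qed
  show ?thesis
    unfolding intertwining_defect_def 1 2
    by (simp add: pl_d1_def bilinear_over_zero_left[OF assms(4)]
        bilinear_over_zero_right[OF assms(4)])
qed

text \<open>The post-Lie identities are evaluated at constant series, mapped by
  \<open>fps_extend \<phi>\<close> and compared at order \<open>n\<close>. Brackets and defects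
  vanish below \<open>n\<close>, so at order \<open>n\<close> they enter only through
  \<open>\<pi>t n\<close> and the defect of order \<open>n\<close>, evaluated at constant terms.
  \<open>tri_derivation\<close> yields the component with \<open>\<pi>t n\<close> alone,
  \<open>tri_action\<close> the other.\<close>

lemma intertwining_defect_cocycle:
  fixes \<omega> :: "'a::real_vector \<Rightarrow> 'a \<Rightarrow> 'a"
  assumes pre: "pre_lie_algebra scaleR \<omega>"
    and def: "formal_post_lie_deformation \<omega> \<pi>t \<omega>t"
    and lin: "\<And>i. linear (\<phi> i)" and id: "\<phi> 0 = id"
    and \<pi>0: "\<And>k. k < n \<Longrightarrow> \<pi>t k = (\<lambda>_ _. 0)"
    and D0: "\<And>k. k < n \<Longrightarrow> intertwining_defect \<omega> \<omega>t \<phi> k = (\<lambda>_ _. 0)"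
  shows "(\<pi>t n, intertwining_defect \<omega> \<omega>t \<phi> n) \<in> pl_Z2 \<omega>"
proof -
  note bil = pre_lie_algebra_bilinear[OF pre]
  define E where "E = intertwining_defect \<omega> \<omega>t \<phi> n"
  define P where "P = fps_extend2 \<pi>t"
  define V where "V = fps_extend2 \<omega>t"
  define W where "W = fps_extend2 (constant_family \<omega>)"
  define D where "D = fps_extend2 (intertwining_defect \<omega> \<omega>t \<phi>)"
  define \<Phi> where "\<Phi> = fps_extend \<phi>"
  have \<pi>t: "bilinear_over scaleR (\<pi>t i)" "alternating (\<pi>t i)"
    and \<omega>t: "bilinear_over scaleR (\<omega>t i)" for i
    using def by (auto simp: formal_post_lie_deformation_def)
  have \<pi>t0: "\<pi>t 0 = (\<lambda>_ _. 0)" and \<omega>t0: "\<omega>t 0 = \<omega>" and pl: "post_lie_algebra fps_scaleR P V"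
    using def by (auto simp: formal_post_lie_deformation_def P_def V_def)
  have E: "bilinear_over scaleR E"
    unfolding E_def using bil \<omega>t lin by (rule intertwining_defect_bilinear)
  have V0: "fps_nth (V X Y) 0 = \<omega> (fps_nth X 0) (fps_nth Y 0)" for X Y
    by (simp add: V_def fps_extend2_def \<omega>t0)
  have P_0: "fps_nth (P X Y) 0 = 0" for X Y
    by (simp add: P_def fps_extend2_def \<pi>t0)
  have P_low: "fps_nth (P X Y) k = 0" if "k < n" for X Y k
    using that \<pi>0 unfolding P_def by (subst fps_extend2_lowest_coeff) auto
  have P_n: "fps_nth (P X Y) n = \<pi>t n (fps_nth X 0) (fps_nth Y 0)" for X Y
    using \<pi>0 unfolding P_def by (rule fps_extend2_lowest_coeff)
  have D_low: "fps_nth (D X Y) k = 0" if "k < n" for X Y k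
    using that D0 unfolding D_def by (subst fps_extend2_lowest_coeff) auto
  have D_n: "fps_nth (D X Y) n = E (fps_nth X 0) (fps_nth Y 0)" for X Y
    using D0 unfolding D_def E_def by (rule fps_extend2_lowest_coeff)
  have \<Phi>P_low: "fps_nth (\<Phi> (P X Y)) k = 0" if "k < n" for X Y k
    unfolding \<Phi>_def using that P_low
    by (subst fps_extend_lowest_coeff[OF lin]) (auto simp: linear_0[OF lin])
  have \<Phi>P_n: "fps_nth (\<Phi> (P X Y)) n = \<pi>t n (fps_nth X 0) (fps_nth Y 0)" for X Y
    unfolding \<Phi>_def using P_low
    by (subst fps_extend_lowest_coeff[OF lin]) (auto simp: id P_n)
  have \<Phi>0: "fps_nth (\<Phi> X) 0 = fps_nth X 0" for X
    by (simp add: \<Phi>_def fps_extend_def id)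

  have der: "\<omega> x (\<pi>t n y z) - \<pi>t n (\<omega> x y) z + \<pi>t n (\<omega> x z) y = 0" for x y z
  proof -
    let ?x = "fps_const x" and ?y = "fps_const y" and ?z = "fps_const z"
    have low: "fps_nth (\<Phi> (P ?y ?z)) k = 0" if "k < n" for k
      using that by (rule \<Phi>P_low)
    have "\<Phi> (V ?x (P ?y ?z)) = W (\<Phi> ?x) (\<Phi> (P ?y ?z)) + D ?x (P ?y ?z)"
      unfolding \<Phi>_def V_def W_def D_def by (rule fps_extend2_intertwining_defect[OF bil lin])
    \<comment> \<open>The series \<open>P ?y ?z\<close> has constant term 0, so the defect term
      contributes \<open>E x 0 = 0\<close> at order \<open>n\<close>.\<close>
    then have 1: "fps_nth (\<Phi> (V ?x (P ?y ?z))) n = \<omega> x (\<pi>t n y z)"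
      using fps_extend2_constant_lowest_coeff_right[OF bil low]
      by (simp add: W_def D_n P_0 bilinear_over_zero_right[OF E] \<Phi>P_n \<Phi>0)
    have "\<Phi> (V ?x (P ?y ?z)) = \<Phi> (P (V ?x ?y) ?z) + \<Phi> (P ?y (V ?x ?z))"
      by (simp add: post_lie_algebra.tri_derivation[OF pl] \<Phi>_def fps_extend_add[OF lin])
    then have "\<omega> x (\<pi>t n y z) = \<pi>t n (\<omega> x y) z + \<pi>t n y (\<omega> x z)"
      using 1 by (simp add: \<Phi>P_n V0)
    then show ?thesis by (simp add: alternating_swap[OF \<pi>t, of n y])
  qed

  have act: "- \<omega> (E x y - E y x + \<pi>t n x y) z - E (\<omega> x y - \<omega> y x) z
        + E x (\<omega> y z) + \<omega> x (E y z) - E y (\<omega> x z) - \<omega> y (E x z) = 0" for x y z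
  proof -
    let ?x = "fps_const x" and ?y = "fps_const y" and ?z = "fps_const z"
    \<comment> \<open>\<open>?C\<close> is what remains of
      \<open>\<Phi> (P ?x ?y + V ?x ?y - V ?y ?x)\<close> once the commutator of
      \<open>\<Phi> ?x\<close> and \<open>\<Phi> ?y\<close> under \<open>W\<close> is subtracted;
      its coefficients below \<open>n\<close> vanish.\<close>
    let ?C = "\<Phi> (P ?x ?y) + D ?x ?y - D ?y ?x"
    have \<Phi>V: "\<Phi> (V X Y) = W (\<Phi> X) (\<Phi> Y) + D X Y" for X Y
      unfolding \<Phi>_def V_def W_def D_def by (rule fps_extend2_intertwining_defect[OF bil lin])
    have \<Phi>_add: "\<Phi> (X + Y) = \<Phi> X + \<Phi> Y" and \<Phi>_diff: "\<Phi> (X - Y) = \<Phi> X - \<Phi> Y" for X Y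
      by (simp_all add: \<Phi>_def fps_extend_add[OF lin] fps_extend_diff[OF lin])
    have W_add: "W (X + X') Y = W X Y + W X' Y" and W_diff: "W (X - X') Y = W X Y - W X' Y"
      and W_add_right: "W X (Y + Y') = W X Y + W X Y'" for X X' Y Y'
      by (simp_all add: W_def fps_extend2_constant_add_left[OF bil]
          fps_extend2_constant_diff_left[OF bil] fps_extend2_constant_add_right[OF bil])
    \<comment> \<open>Left symmetry, solved for one term to serve as a rewrite rule, cancels all
      terms built from \<open>W\<close> and \<open>\<Phi>\<close> alone.\<close>
    have sym: "W (W (\<Phi> ?x) (\<Phi> ?y)) (\<Phi> ?z) = W (W (\<Phi> ?y) (\<Phi> ?x)) (\<Phi> ?z)
        + W (\<Phi> ?x) (W (\<Phi> ?y) (\<Phi> ?z)) - W (\<Phi> ?y) (W (\<Phi> ?x) (\<Phi> ?z))"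
      using fps_extend2_constant_left_symmetric[OF pre, of "\<Phi> ?x" "\<Phi> ?y" "\<Phi> ?z"]
      by (simp add: W_def algebra_simps)
    have "\<Phi> (V (P ?x ?y + V ?x ?y - V ?y ?x) ?z) = \<Phi> (V ?x (V ?y ?z)) - \<Phi> (V ?y (V ?x ?z))"
      by (simp add: post_lie_algebra.tri_action[OF pl] \<Phi>_diff)
    then have "W ?C (\<Phi> ?z) + D (P ?x ?y + V ?x ?y - V ?y ?x) ?z
        = W (\<Phi> ?x) (D ?y ?z) + D ?x (V ?y ?z) - W (\<Phi> ?y) (D ?x ?z) - D ?y (V ?x ?z)"
      by (simp add: sym \<Phi>V \<Phi>_add \<Phi>_diff W_add W_diff W_add_right algebra_simps)
    from arg_cong[where f = "\<lambda>X. fps_nth X n", OF this]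
    have coeff: "fps_nth (W ?C (\<Phi> ?z)) n + E (\<omega> x y - \<omega> y x) z
        = fps_nth (W (\<Phi> ?x) (D ?y ?z)) n + E x (\<omega> y z)
          - fps_nth (W (\<Phi> ?y) (D ?x ?z)) n - E y (\<omega> x z)"
      by (simp add: D_n P_0 V0)
    have WC: "fps_nth (W ?C (\<Phi> ?z)) n = \<omega> (\<pi>t n x y + E x y - E y x) z"
      unfolding W_def by (subst fps_extend2_constant_lowest_coeff_left[OF bil])
        (simp_all add: \<Phi>P_low D_low \<Phi>P_n D_n \<Phi>0)
    have WD: "fps_nth (W (\<Phi> (fps_const u)) (D (fps_const v) ?z)) n = \<omega> u (E v z)" for u v
      unfolding W_def by (subst fps_extend2_constant_lowest_coeff_right[OF bil])
        (simp_all add: D_low D_n \<Phi>0)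
    show ?thesis
      using coeff unfolding WC WD bilinear_over_neg_left[OF bil]
      by (simp add: bilinear_over_add_left[OF bil] bilinear_over_diff_left[OF bil] algebra_simps)
  qed

  show ?thesis
    using \<pi>t E der act
    by (simp add: pl_Z2_def pl_C2_def pl_d2_def zero_prod_def zero_fun_def E_def fun_eq_iff)
qed

theorem theorem3p15:
  fixes \<omega> :: "'a::real_vector \<Rightarrow> 'a \<Rightarrow> 'a"
  assumes "pre_lie_algebra scaleR \<omega>"
    and "pl_H2 \<omega> = {pl_B2 \<omega>}"
  shows "post_lie_rigid \<omega>"
  unfolding post_lie_rigid_def
proof (intro allI impI)
  fix \<pi>t \<omega>t
  assume def: "formal_post_lie_deformation \<omega> \<pi>t \<omega>t"
  then have \<pi>t0: "\<pi>t 0 = (\<lambda>_ _. 0)" and \<omega>t0: "\<omega>t 0 = \<omega>"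
    by (auto simp: formal_post_lie_deformation_def)
  note bil = pre_lie_algebra_bilinear[OF assms(1)]
  let ?D = "intertwining_defect \<omega> \<omega>t"
  have D_cong: "?D f n = ?D g n" if "\<And>k. k \<le> n \<Longrightarrow> f k = g k" for f g n
    using that by (simp add: intertwining_defect_def fun_eq_iff)
  \<comment> \<open>\<open>Q f n r\<close> says that \<open>r\<close> may serve as coefficient of
    order \<open>n\<close> after those of \<open>f\<close>. The condition on \<open>\<pi>t n\<close>
    does not involve \<open>r\<close>, but the induction carries it because the cocycle property at
    later orders relies on it.\<close>
  define Q where "Q f n r \<longleftrightarrow> linear r \<and> (n = 0 \<longrightarrow> r = id) \<and> \<pi>t n = (\<lambda>_ _. 0)
      \<and> ?D (f(n := r)) n = (\<lambda>_ _. 0)" for f n r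
  have "\<exists>\<phi>. \<forall>n. Q \<phi> n (\<phi> n)"
  \<comment> \<open>The choice principle requires that \<open>Q f n r\<close> depend on
    \<open>f\<close> only below \<open>n\<close>. The update \<open>f(n := r)\<close> and
    \<open>D_cong\<close> ensure this, since the defect of order \<open>n\<close> reads no later
    coefficients.\<close>
  proof (rule dependent_wf_choice[OF wf_less_than])
    fix f g :: "nat \<Rightarrow> 'a \<Rightarrow> 'a" and n r
    assume "\<And>k. (k, n) \<in> less_than \<Longrightarrow> f k = g k"
    then have "?D (f(n := r)) n = ?D (g(n := r)) n" by (intro D_cong) auto
    then show "Q f n r = Q g n r" by (simp add: Q_def)
  next
    fix n and f :: "nat \<Rightarrow> 'a \<Rightarrow> 'a"
    assume "\<And>k. (k, n) \<in> less_than \<Longrightarrow> Q f k (f k)"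
    then have IH: "Q f k (f k)" if "k < n" for k using that by simp
    show "\<exists>r. Q f n r"
    proof (cases "n = 0")
      case True
      then have "Q f n id"
        by (simp add: Q_def linear_id \<pi>t0 \<omega>t0 intertwining_defect_def fun_eq_iff)
      then show ?thesis by blast
    next
      case False
      \<comment> \<open>Nothing is known about \<open>f\<close> from \<open>n\<close> on, so those
        values are replaced by the zero map: the cocycle lemma asks for linearity at every
        index.\<close>
      define \<phi> where "\<phi> k = (if k < n then f k else (\<lambda>_. 0))" for k
      have lin: "linear (\<phi> k)" for k
        using IH by (simp add: \<phi>_def Q_def linear_zero)
      have id: "f 0 = id" "\<phi> 0 = id"
        using IH[of 0] False by (auto simp: \<phi>_def Q_def)
      have D0: "?D \<phi> k = (\<lambda>_ _. 0)" if "k < n" for k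
      proof -
        have "?D \<phi> k = ?D (f(k := f k)) k" using that by (intro D_cong) (simp add: \<phi>_def)
        then show ?thesis using IH[OF that] by (simp add: Q_def)
      qed
      have "(\<pi>t n, ?D \<phi> n) \<in> pl_Z2 \<omega>"
        using IH D0 by (intro intertwining_defect_cocycle assms(1) def lin id(2)) (simp_all add: Q_def)
      then have "(\<pi>t n, ?D \<phi> n) \<in> pl_B2 \<omega>"
        using pl_Z2_subset_B2[OF bil assms(2)] by blast
      \<comment> \<open>The first component of \<open>pl_d1 \<omega> r\<close> is zero, so the
        equation also gives \<open>\<pi>t n = (\<lambda>_ _. 0)\<close>; its second component lets
        \<open>r\<close> cancel the defect of order \<open>n\<close>.\<close>
      then obtain r where r: "linear r" "(\<pi>t n, ?D \<phi> n) = pl_d1 \<omega> r"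
        by (auto simp: pl_B2_def pl_C1_def)
      have "?D (f(n := \<lambda>_. 0)) n = ?D \<phi> n"
        by (intro D_cong) (auto simp: \<phi>_def)
      moreover have "snd (pl_d1 \<omega> r) = ?D \<phi> n"
        by (simp flip: r(2))
      ultimately have "?D (f(n := r)) n = (\<lambda>_ _. 0)"
        using intertwining_defect_upd[of n f \<omega>t \<omega> scaleR r] False id(1) \<omega>t0 bil
        by (simp add: fun_eq_iff)
      then have "Q f n r" using r False by (simp add: Q_def pl_d1_def)
      then show ?thesis by blast
    qed
  qed
  then obtain \<phi> where \<phi>: "\<And>n. Q \<phi> n (\<phi> n)" by blast
  have lin: "linear (\<phi> i)" for i using \<phi> by (simp add: Q_def)
  have "\<pi>t = (\<lambda>_ _ _. 0)" using \<phi> by (simp add: Q_def fun_eq_iff)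
  then have "fps_extend \<phi> (fps_extend2 \<pi>t X Y) = 0" for X Y
    by (simp add: fps_eq_iff fps_extend_def fps_extend2_def linear_0[OF lin])
  \<comment> \<open>\<open>\<phi>(n := \<phi> n)\<close> is \<open>\<phi>\<close> itself, so
    \<open>Q\<close> now speaks of the defects of the whole family.\<close>
  moreover have "?D \<phi> = (\<lambda>_ _ _. 0)" using \<phi> by (simp add: Q_def fun_eq_iff)
  then have "fps_extend \<phi> (fps_extend2 \<omega>t X Y)
      = fps_extend2 (constant_family \<omega>) (fps_extend \<phi> X) (fps_extend \<phi> Y)" for X Y
    unfolding fps_extend2_intertwining_defect[OF bil lin]
    by (simp add: fps_eq_iff fps_extend2_def)
  ultimately show "trivial_deformation \<omega> \<pi>t \<omega>t"
    unfolding trivial_deformation_def using lin \<phi>[of 0] by (auto simp: Q_def)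
qed

end
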